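(* Let $\mathcal{A}=(a_n)_{n\in\mathbb{N}_+}$ be a sequence of positive integers and let $m>1$ be an integer. For each positive integer $k$, \[ \lim_{N\to\infty}\frac{\#\{n\leqslant N:\ p_\mathcal{A}(n,k)\not\equiv 0\pmod{m}\}}{N}\geqslant\frac{1}{\sum_{i=1}^k a_i}. \]
   Context: $\mathbb{N}=\{0,1,2,\ldots\}$, and $n$ ranges over $\mathbb{N}$. For $k\in\mathbb{N}_+$ and $n\in\mathbb{N}$, $p_\mathcal{A}(n,k)$ is the number of tuples $(x_1,\ldots,x_k)\in\mathbb{N}^k$ with $a_1x_1+\cdots+a_kx_k=n$, i.e. $\sum_{n\ge0}p_\mathcal{A}(n,k)x^n=\prod_{i=1}^k(1-x^{a_i})^{-1}$. *)

theory Defs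
  imports Complex_Main "HOL-Library.FuncSet" "HOL-Number_Theory.Cong"
begin

text \<open>
  A sequence indexed by the positive integers is a function on \<^typ>\<open>nat\<close> whose value at \<open>0\<close> is never used.
  A \<open>k\<close>-tuple of natural numbers is an extensional function on \<open>{1..k}\<close>, so that distinct
  functions are distinct tuples. The set below is finite whenever \<open>a 1, \<dots>, a k\<close> are positive.
\<close>

definition restricted_partitions :: "(nat \<Rightarrow> nat) \<Rightarrow> nat \<Rightarrow> nat \<Rightarrow> nat" where
  "restricted_partitions a n k =
     card {x \<in> {1..k} \<rightarrow>\<^sub>E (UNIV :: nat set). (\<Sum>i=1..k. a i * x i) = n}"

end

theory Submission
  imports Defs
begin

text \<open>
  Write \<open>p\<^sub>k n\<close> for the number of restricted partitions. From
  \<open>p\<^sub>k (n + a\<^sub>k) = p\<^sub>k n + p\<^sub>k\<^sub>-\<^sub>1 (n + a\<^sub>k)\<close> it follows by induction on \<open>k\<close> that \<open>p\<^sub>k\<close> is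
  eventually periodic modulo \<open>m\<close>, so the density exists. Moreover, if \<open>p\<^sub>k\<close> vanished modulo \<open>m\<close> on a
  window of length \<open>a\<^sub>1 + \<dots> + a\<^sub>k\<close>, then \<open>p\<^sub>k\<^sub>-\<^sub>1\<close> would vanish on the window obtained by removing
  its first \<open>a\<^sub>k\<close> elements; descending to \<open>k = 1\<close> this is absurd, as \<open>p\<^sub>1\<close> is the indicator of the
  multiples of \<open>a\<^sub>1\<close>. Hence every such window contributes to the density.
\<close>

lemma finite_restricted_partitions:
  fixes a :: "nat \<Rightarrow> nat"
  assumes "\<And>i. i \<ge> 1 \<Longrightarrow> a i > 0"
  shows "finite {x \<in> {1..k} \<rightarrow>\<^sub>E (UNIV :: nat set). (\<Sum>i=1..k. a i * x i) = n}"
proof (rule finite_subset)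
  show "{x \<in> {1..k} \<rightarrow>\<^sub>E (UNIV :: nat set). (\<Sum>i=1..k. a i * x i) = n} \<subseteq> {1..k} \<rightarrow>\<^sub>E {..n}"
  proof
    fix x assume x: "x \<in> {x \<in> {1..k} \<rightarrow>\<^sub>E (UNIV :: nat set). (\<Sum>i=1..k. a i * x i) = n}"
    have "x i \<le> n" if i: "i \<in> {1..k}" for i
    proof -
      have "x i \<le> a i * x i" using assms[of i] i by simp
      also have "\<dots> \<le> (\<Sum>i=1..k. a i * x i)"
        using i by (intro member_le_sum) auto
      finally show ?thesis using x by simp
    qed
    with x show "x \<in> {1..k} \<rightarrow>\<^sub>E {..n}" by (auto simp: PiE_iff)
  qed
qed (simp add: finite_PiE)

text \<open>Split the tuples of weight \<open>n + a (Suc k)\<close> by their last entry: a positive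
  entry can be lowered by one, giving weight \<open>n\<close>, and a zero entry can be deleted,
  leaving a \<open>k\<close>-tuple.\<close>

lemma restricted_partitions_rec:
  fixes a :: "nat \<Rightarrow> nat"
  assumes pos: "\<And>i. i \<ge> 1 \<Longrightarrow> a i > 0"
  shows "restricted_partitions a (n + a (Suc k)) (Suc k) =
    restricted_partitions a n (Suc k) + restricted_partitions a (n + a (Suc k)) k"
proof -
  define X where "X k n = {x \<in> {1..k} \<rightarrow>\<^sub>E (UNIV :: nat set). (\<Sum>i=1..k. a i * x i) = n}" for k n
  have card_X: "restricted_partitions a n k = card (X k n)" for k n
    by (simp add: restricted_partitions_def X_def)
  have fin: "finite (X k n)" for k n
    unfolding X_def by (rule finite_restricted_partitions) (rule pos)
  let ?N = "n + a (Suc k)"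
  let ?A = "{x \<in> X (Suc k) ?N. x (Suc k) > 0}" and ?B = "{x \<in> X (Suc k) ?N. x (Suc k) = 0}"
  have sum_upd: "(\<Sum>i=1..k. a i * (if i = Suc k then v else x i)) = (\<Sum>i=1..k. a i * x i)" for x v
    by (rule sum.cong) auto
  have "bij_betw (\<lambda>x. x(Suc k := Suc (x (Suc k)))) (X (Suc k) n) ?A"
    by (rule bij_betw_byWitness[where f' = "\<lambda>x. x(Suc k := x (Suc k) - 1)"])
       (auto simp: X_def sum_upd PiE_iff extensional_def gr0_conv_Suc algebra_simps)
  \<comment> \<open>Extensional \<open>k\<close>-tuples are \<open>undefined\<close> at
    \<open>Suc k\<close>, so deleting the entry means resetting it to
    \<open>undefined\<close>.\<close>
  moreover have "bij_betw (\<lambda>x. x(Suc k := 0)) (X k ?N) ?B"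
    by (rule bij_betw_byWitness[where f' = "\<lambda>x. x(Suc k := undefined)"])
       (auto simp: X_def sum_upd PiE_iff extensional_def)
  ultimately have "card (X (Suc k) n) = card ?A" "card (X k ?N) = card ?B"
    by (auto dest: bij_betw_same_card)
  moreover have "card (X (Suc k) ?N) = card ?A + card ?B"
    using fin[of "Suc k" ?N] by (subst card_Un_disjoint[symmetric]) (auto intro: arg_cong[where f = card])
  ultimately show ?thesis by (simp add: card_X)
qed

lemma restricted_partitions_0_right:
  "restricted_partitions a n 0 = (if n = 0 then 1 else 0)"
  by (simp add: restricted_partitions_def)

text \<open>The recurrence at \<open>k = 0\<close> carries the value along steps of
  \<open>a 1\<close>, since the empty tuple has weight 0 only.\<close>

lemma restricted_partitions_1_multiple:
  fixes a :: "nat \<Rightarrow> nat"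
  assumes pos: "\<And>i. i \<ge> 1 \<Longrightarrow> a i > 0"
  shows "restricted_partitions a (a 1 * j) 1 = 1"
proof (induction j)
  case 0
  have "{x \<in> {1..1} \<rightarrow>\<^sub>E (UNIV :: nat set). (\<Sum>i=1..1. a i * x i) = 0} = {\<lambda>i\<in>{1}. 0}"
    using pos[of 1] by (auto simp: PiE_iff extensional_def restrict_def fun_eq_iff)
  then show ?case by (simp add: restricted_partitions_def)
next
  case (Suc j)
  then show ?case
    using restricted_partitions_rec[where a = a, OF pos, where n = "a 1 * j" and k = 0] pos[of 1]
    by (simp add: restricted_partitions_0_right algebra_simps)
qed

lemma restricted_partitions_window:
  fixes a :: "nat \<Rightarrow> nat"
  assumes pos: "\<And>i. i \<ge> 1 \<Longrightarrow> a i > 0" and "m > 1" and "k \<ge> 1"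
  shows "\<exists>l\<in>{n..<n + (\<Sum>i=1..k. a i)}. \<not> [restricted_partitions a l k = 0] (mod m)"
  using \<open>k \<ge> 1\<close>
proof (induction k arbitrary: n rule: dec_induct)
  case base
  have a1: "a 1 > 0" using pos by simp
  \<comment> \<open>The least multiple of \<open>a 1\<close> that is at least
    \<open>n\<close>.\<close>
  define l where "l = a 1 * ((n + a 1 - 1) div a 1)"
  have "l + (n + a 1 - 1) mod a 1 = n + a 1 - 1"
    unfolding l_def by (rule mult_div_mod_eq)
  moreover have "(n + a 1 - 1) mod a 1 < a 1" using a1 by simp
  ultimately have "l \<in> {n..<n + a 1}" using a1 unfolding atLeastLessThan_iff by linarith
  moreover have "restricted_partitions a l 1 = 1"
    unfolding l_def by (rule restricted_partitions_1_multiple) (rule pos)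
  ultimately show ?case using \<open>m > 1\<close> by (intro bexI[of _ l]) (auto simp: cong_def)
next
  case (step k)
  let ?b = "a (Suc k)"
  \<comment> \<open>The window is shifted by \<open>?b\<close> so that both \<open>l\<close> and
    \<open>l - ?b\<close> lie in the longer window starting at \<open>n\<close>.\<close>
  obtain l where l: "l \<in> {n + ?b..<n + ?b + (\<Sum>i=1..k. a i)}"
    and nz: "\<not> [restricted_partitions a l k = 0] (mod m)"
    using step.IH by blast
  have rec: "restricted_partitions a l (Suc k) =
      restricted_partitions a (l - ?b) (Suc k) + restricted_partitions a l k"
    using restricted_partitions_rec[where a = a, OF pos, where n = "l - ?b" and k = k] l by simp
  \<comment> \<open>If both values vanished modulo \<open>m\<close>, so would their difference, the
    value for \<open>k\<close> at \<open>l\<close>.\<close>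
  have "\<not> [restricted_partitions a l (Suc k) = 0] (mod m) \<or>
        \<not> [restricted_partitions a (l - ?b) (Suc k) = 0] (mod m)"
    using nz by (auto simp: rec cong_0_iff dvd_add_right_iff)
  moreover have "l \<in> {n..<n + (\<Sum>i=1..Suc k. a i)}" "l - ?b \<in> {n..<n + (\<Sum>i=1..Suc k. a i)}"
    using l by auto
  ultimately show ?case by blast
qed

lemma cong_periodic_mult:
  fixes f :: "nat \<Rightarrow> nat"
  assumes "\<And>n. n \<ge> n0 \<Longrightarrow> [f (n + T) = f n] (mod m)" and "n \<ge> n0"
  shows "[f (n + r * T) = f n] (mod m)"
proof (induction r)
  case (Suc r)
  have "[f (n + r * T + T) = f (n + r * T)] (mod m)"
    using assms(2) by (intro assms(1)) simp
  with Suc show ?case by (auto simp: algebra_simps intro: cong_trans)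
qed simp

text \<open>If \<open>T\<close> is a period for \<open>k\<close>, then \<open>T\<close> steps of
  length \<open>?b\<close> change the value for \<open>Suc k\<close> by \<open>?d n\<close>, which
  is itself periodic modulo \<open>m\<close>. After \<open>m\<close> such blocks the total change is
  a multiple of \<open>m\<close>.\<close>

lemma restricted_partitions_eventually_periodic:
  fixes a :: "nat \<Rightarrow> nat"
  assumes pos: "\<And>i. i \<ge> 1 \<Longrightarrow> a i > 0" and "m > 0"
  shows "\<exists>T>0. \<exists>n0. \<forall>n\<ge>n0. [restricted_partitions a (n + T) k = restricted_partitions a n k] (mod m)"
proof (induction k)
  case 0
  then show ?case
    \<comment> \<open>Both \<open>T\<close> and \<open>n0\<close> are 1; starting at 1 skips the
      exceptional value at 0.\<close>
    by (intro exI[of _ 1] conjI exI[of _ 1]) (auto simp: restricted_partitions_0_right)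
next
  case (Suc k)
  then obtain T n0 where "T > 0"
    and per: "\<And>n. n \<ge> n0 \<Longrightarrow> [restricted_partitions a (n + T) k = restricted_partitions a n k] (mod m)"
    by blast
  let ?b = "a (Suc k)"
  let ?f = "\<lambda>n. restricted_partitions a n (Suc k)"
  let ?d = "\<lambda>n. \<Sum>j=1..T. restricted_partitions a (n + j * ?b) k"
  have sum_rec: "?f (n + r * ?b) = ?f n + (\<Sum>j=1..r. restricted_partitions a (n + j * ?b) k)" for n r
  proof (induction r)
    case (Suc r)
    then show ?case
      using restricted_partitions_rec[where a = a, OF pos, where n = "n + r * ?b" and k = k]
      by (simp add: algebra_simps)
  qed simp
  \<comment> \<open>Each summand is shifted by \<open>r * ?b\<close> periods of length
    \<open>T\<close>.\<close>
  have d_per: "[?d (n + r * (?b * T)) = ?d n] (mod m)" if "n \<ge> n0" for n r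
  proof (rule cong_sum)
    fix j
    have "[restricted_partitions a (n + j * ?b + (r * ?b) * T) k =
        restricted_partitions a (n + j * ?b) k] (mod m)"
      using cong_periodic_mult[where f = "\<lambda>n. restricted_partitions a n k" and T = T
          and n = "n + j * ?b" and r = "r * ?b", OF per] that by simp
    then show "[restricted_partitions a (n + r * (?b * T) + j * ?b) k =
        restricted_partitions a (n + j * ?b) k] (mod m)"
      by (simp add: algebra_simps)
  qed
  have shift: "[?f (n + r * (?b * T)) = ?f n + r * ?d n] (mod m)" if "n \<ge> n0" for n r
  proof (induction r)
    case (Suc r)
    have step: "?f (n + Suc r * (?b * T)) = ?f (n + r * (?b * T)) + ?d (n + r * (?b * T))"
      using sum_rec[of "n + r * (?b * T)" T] by (simp add: algebra_simps)
    show ?case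
      using cong_add[OF Suc d_per[OF that, of r]] unfolding step by (simp add: ac_simps)
  qed simp
  have "[?f (n + m * (?b * T)) = ?f n] (mod m)" if "n \<ge> n0" for n
    using shift[OF that, of m] by (simp add: cong_def)
  moreover have "m * (?b * T) > 0"
    using \<open>m > 0\<close> \<open>T > 0\<close> pos[of "Suc k"] by simp
  ultimately show ?case by blast
qed

lemma card_atMost_Suc_filter:
  "card {n. n \<le> Suc N \<and> P n} = card {n. n \<le> N \<and> P n} + (if P (Suc N) then 1 else 0)"
proof -
  have "{n. n \<le> Suc N \<and> P n} = {n. n \<le> N \<and> P n} \<union> (if P (Suc N) then {Suc N} else {})"
    by (auto simp: le_Suc_eq)
  then show ?thesis by simp
qed

text \<open>Descending in steps of \<open>T\<close> reaches an index below \<open>n0 + T\<close>, so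
  a maximum over finitely many values suffices.\<close>

lemma eventually_periodic_bounded:
  fixes g :: "nat \<Rightarrow> real"
  assumes "T > 0" and per: "\<And>n. n \<ge> n0 \<Longrightarrow> g (n + T) = g n"
  shows "\<exists>B. \<forall>n. \<bar>g n\<bar> \<le> B"
proof -
  define B where "B = Max ((\<lambda>n. \<bar>g n\<bar>) ` {..<n0 + T})"
  have "\<bar>g n\<bar> \<le> B" for n
  proof (induction n rule: less_induct)
    case (less n)
    show ?case
    proof (cases "n < n0 + T")
      case True
      then show ?thesis unfolding B_def by (intro Max_ge) auto
    next
      case False
      then show ?thesis using less[of "n - T"] per[of "n - T"] \<open>T > 0\<close> by simp
    qed
  qed
  then show ?thesis by blast
qed

text \<open>Past \<open>n0\<close> the counting function gains a fixed \<open>c\<close> per period.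
  Subtracting the line of slope \<open>c / T\<close> leaves a bounded function, so the density is
  \<open>c / T\<close>.\<close>

lemma eventually_periodic_density:
  fixes P :: "nat \<Rightarrow> bool"
  assumes "T > 0" and per: "\<And>n. n \<ge> n0 \<Longrightarrow> P (n + T) = P n"
  shows "\<exists>L::real. (\<lambda>N. real (card {n. n \<le> N \<and> P n}) / real N) \<longlonglongrightarrow> L"
proof -
  define f where "f N = real (card {n. n \<le> N \<and> P n})" for N
  have f_Suc: "f (Suc N) = f N + (if P (Suc N) then 1 else 0)" for N
    unfolding f_def card_atMost_Suc_filter by simp
  define c where "c = f (n0 + T) - f n0"
  have f_per: "f (n + T) = f n + c" if "n \<ge> n0" for n
    using that
  proof (induction n rule: dec_induct)
    case base
    then show ?case by (simp add: c_def)
  next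
    case (step n)
    then show ?case using f_Suc[of n] f_Suc[of "n + T"] per[of "Suc n"] by simp
  qed
  define g where "g N = f N - c / T * N" for N
  have "g (n + T) = g n" if "n \<ge> n0" for n
    using f_per[OF that] \<open>T > 0\<close> by (simp add: g_def field_simps)
  then obtain B where B: "\<And>n. \<bar>g n\<bar> \<le> B"
    using eventually_periodic_bounded[OF \<open>T > 0\<close>, of n0 g] by blast
  have "(\<lambda>N. g N / real N) \<longlonglongrightarrow> 0"
  proof (rule tendsto_rabs_zero_cancel, rule tendsto_sandwich[OF _ _ tendsto_const])
    show "\<forall>\<^sub>F N in sequentially. \<bar>g N / real N\<bar> \<le> B / real N"
      using B by (intro always_eventually allI) (simp add: divide_right_mono)
  qed (simp_all add: lim_const_over_n)
  then have "(\<lambda>N. g N / real N + c / T) \<longlonglongrightarrow> 0 + c / T"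
    by (intro tendsto_add tendsto_const)
  \<comment> \<open>Restricting to positive \<open>N\<close> avoids division by zero.\<close>
  moreover have "\<forall>\<^sub>F N in sequentially. g N / real N + c / T = f N / real N"
    using eventually_gt_at_top[of 0] by eventually_elim (simp add: g_def field_simps)
  ultimately have "(\<lambda>N. f N / real N) \<longlonglongrightarrow> 0 + c / T"
    by (rule Lim_transform_eventually)
  then show ?thesis unfolding f_def by (rule exI)
qed

text \<open>Consecutive disjoint windows contribute at least one element each; as the limit is known
  to exist, it can be read off along the multiples of \<open>S\<close>.\<close>

lemma window_density_ge:
  fixes P :: "nat \<Rightarrow> bool"
  assumes "S > 0" and win: "\<And>n. \<exists>l\<in>{n..<n + S}. P l"
    and lim: "(\<lambda>N. real (card {n. n \<le> N \<and> P n}) / real N) \<longlonglongrightarrow> L"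
  shows "L \<ge> 1 / real S"
proof -
  have count: "card {n. n \<le> S * j \<and> P n} \<ge> j" for j
  proof (induction j)
    case (Suc j)
    \<comment> \<open>Starting just after \<open>S * j\<close> makes \<open>l\<close> a new element,
      and the window ends exactly at \<open>S * Suc j\<close>.\<close>
    obtain l where l: "l \<in> {Suc (S * j)..<Suc (S * j) + S}" "P l"
      using win by blast
    have "Suc j \<le> card (insert l {n. n \<le> S * j \<and> P n})"
      using Suc l by simp
    also have "\<dots> \<le> card {n. n \<le> S * Suc j \<and> P n}"
      using l by (intro card_mono) auto
    finally show ?case .
  qed simp
  have "(\<lambda>j. real (card {n. n \<le> S * j \<and> P n}) / real (S * j)) \<longlonglongrightarrow> L"
    using LIMSEQ_subseq_LIMSEQ[OF lim, of "\<lambda>j. S * j"] \<open>S > 0\<close>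
    by (simp add: strict_mono_def o_def)
  moreover have "\<forall>\<^sub>F j in sequentially. 1 / real S \<le> real (card {n. n \<le> S * j \<and> P n}) / real (S * j)"
    using eventually_gt_at_top[of 0]
  proof eventually_elim
    case (elim j)
    then have "1 / real S = real j / real (S * j)" by simp
    also have "\<dots> \<le> real (card {n. n \<le> S * j \<and> P n}) / real (S * j)"
      using count[of j] by (intro divide_right_mono) auto
    finally show ?case .
  qed
  ultimately show ?thesis by (intro tendsto_lowerbound) auto
qed

theorem theorem5p2:
  fixes a :: "nat \<Rightarrow> nat" and m k :: nat
  assumes "\<And>i. i \<ge> 1 \<Longrightarrow> a i > 0"
    and "m > 1"
    and "k \<ge> 1"
  shows "\<exists>L :: real.
    (\<lambda>N. real (card {n. n \<le> N \<and> \<not> [restricted_partitions a n k = 0] (mod m)}) / real N)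
      \<longlonglongrightarrow> L
    \<and> L \<ge> 1 / real (\<Sum>i=1..k. a i)"
proof -
  let ?P = "\<lambda>n. \<not> [restricted_partitions a n k = 0] (mod m)"
  obtain T n0 where "T > 0" and
    per: "\<And>n. n \<ge> n0 \<Longrightarrow> [restricted_partitions a (n + T) k = restricted_partitions a n k] (mod m)"
    using restricted_partitions_eventually_periodic[where a = a, OF assms(1), of m k] assms(2)
    by auto
  have "?P (n + T) = ?P n" if "n \<ge> n0" for n
    using per[OF that] by (simp add: cong_def)
  then obtain L where lim: "(\<lambda>N. real (card {n. n \<le> N \<and> ?P n}) / real N) \<longlonglongrightarrow> L"
    using eventually_periodic_density[OF \<open>T > 0\<close>, of n0 ?P] by blast
  have win: "\<exists>l\<in>{n..<n + (\<Sum>i=1..k. a i)}. ?P l" for n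
    by (rule restricted_partitions_window[where a = a, OF assms])
  \<comment> \<open>The window at 0 contains an element, so its length is positive.\<close>
  have "(\<Sum>i=1..k. a i) > 0"
    using win[of 0] by auto
  from window_density_ge[OF this win lim] lim show ?thesis by blast
qed

end
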